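(* Let $q_0=(x_0,y_0,\theta_0)\in M=\mathbb{R}^2\times S^1$ and $t_1>0$. Then the attainable set from $q_0$ for time $t_1$ of the control system $\dot x=\cos\theta,\ \dot y=\sin\theta,\ \dot\theta=u$, $u\in\mathbb{R}$, is $$\mathcal{A}_{q_0}(t_1)=\{(x,y,\theta)\in M \mid (x-x_0)^2+(y-y_0)^2<t_1^2 \ \text{ or }\ (x,y,\theta)=(x_0+t_1\cos\theta_0,\ y_0+t_1\sin\theta_0,\ \theta_0)\}.$$
   Context: Here $S^1=\mathbb{R}/2\pi\mathbb{Z}$ and $M=\mathbb{R}^2_{x,y}\times S^1_\theta$. Admissible controls are functions $u\in L_2([0,t_1],\mathbb{R})$; trajectories $q(t)=(x(t),y(t),\theta(t))$ are absolutely continuous curves in $M$ satisfying the system for almost every $t$. The attainable set $\mathcal{A}_{q_0}(t_1)$ is the set of all endpoints $q(t_1)$ of trajectories with $q(0)=q_0$ corresponding to admissible controls on $[0,t_1]$. *)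

theory Defs
  imports "HOL-Analysis.Analysis" "HOL-Library.Real_Mod"
begin

section \<open>The circle \<open>\<real> / 2\<pi>\<int>\<close>\<close>

quotient_type circle = real / "\<lambda>x y. [x = y] (rmod (2 * pi))"
  by (rule equivpI) (auto simp: rcong_def reflp_def symp_def transp_def)

lemma abs_circle_eq_iff:
  "abs_circle x = abs_circle y \<longleftrightarrow> (\<exists>k::int. y = x + of_int k * (2 * pi))"
  by (simp add: circle.abs_eq_iff rcong_altdef)

lemma abs_circle_cases: obtains x where "p = abs_circle x"
  by (metis Quotient3_abs_rep Quotient3_circle)

lift_definition cos_circle :: "circle \<Rightarrow> real" is cos
  by (auto simp: rcong_altdef cos_add mult.commute[of _ "2 * pi"])

lift_definition sin_circle :: "circle \<Rightarrow> real" is sin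
  by (auto simp: rcong_altdef sin_add mult.commute[of _ "2 * pi"])

lemma closed_circle_fibre: "closed {y. abs_circle y = p}"
proof (cases p rule: abs_circle_cases)
  case (1 x)
  have "y = z" if yz: "abs_circle y = p" "abs_circle z = p" "dist z y < 2 * pi" for y z
  proof -
    obtain k :: int where k: "z = y + of_int k * (2 * pi)"
      using yz abs_circle_eq_iff by metis
    with yz(3) have "\<bar>real_of_int k\<bar> * (2 * pi) < 1 * (2 * pi)"
      by (simp add: dist_real_def abs_mult)
    then have "\<bar>real_of_int k\<bar> < 1"
      using mult_less_cancel_right_pos[of "2 * pi"] by (simp del: mult_1)
    with k show ?thesis by simp
  qed
  then show ?thesis
    by (intro discrete_imp_closed[of "2 * pi"]) (auto simp: dist_norm)
qed

text \<open>The quotient (arc length) metric: the distance of two fibres in \<open>\<real>\<close>.\<close>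

instantiation circle :: metric_space
begin

definition dist_circle :: "circle \<Rightarrow> circle \<Rightarrow> real" where
  "dist_circle p q = setdist {x. abs_circle x = p} {y. abs_circle y = q}"

definition uniformity_circle :: "(circle \<times> circle) filter" where
  "uniformity_circle = (INF e\<in>{0<..}. principal {(x, y). dist x y < e})"

definition open_circle :: "circle set \<Rightarrow> bool" where
  "open_circle U \<longleftrightarrow> (\<forall>x\<in>U. \<forall>\<^sub>F (x', y) in uniformity. x' = x \<longrightarrow> y \<in> U)"

instance
proof
  have le: "dist p q \<le> \<bar>x - y\<bar>" if "abs_circle x = p" "abs_circle y = q" for p q x y
    unfolding dist_circle_def using that by (metis dist_real_def mem_Collect_eq setdist_le_dist)
  have attained: "\<exists>y. abs_circle y = q \<and> dist p q = \<bar>x - y\<bar>"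
    if x: "abs_circle x = p" for p q x
  proof -
    let ?Q = "{y. abs_circle y = q}"
    have "?Q \<noteq> {}" by (metis abs_circle_cases empty_iff mem_Collect_eq)
    with closed_circle_fibre[of q] obtain y where y: "y \<in> ?Q" "\<And>z. z \<in> ?Q \<Longrightarrow> dist x y \<le> dist x z"
      using distance_attains_inf by blast
    have "\<bar>x - y\<bar> \<le> dist p q"
      unfolding dist_circle_def
    proof (rule le_setdistI)
      fix a b assume "a \<in> {x. abs_circle x = p}" "b \<in> ?Q"
      then obtain k :: int where k: "x = a + of_int k * (2 * pi)"
        using x abs_circle_eq_iff by (metis mem_Collect_eq)
      have "abs_circle (b + of_int k * (2 * pi)) = q"
        using \<open>b \<in> ?Q\<close> abs_circle_eq_iff by (metis mem_Collect_eq)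
      from y(2)[of "b + of_int k * (2 * pi)"] this k
      show "\<bar>x - y\<bar> \<le> dist a b" by (simp add: dist_real_def)
    qed (use \<open>?Q \<noteq> {}\<close> x in auto)
    with le[OF x, of y q] y(1) show ?thesis by (intro exI[of _ y]) auto
  qed
  have sym: "dist p q = dist q p" for p q :: circle
    unfolding dist_circle_def by (rule setdist_sym)
  show "uniformity = (INF e\<in>{0<..}. principal {(x::circle, y). dist x y < e})"
    by (rule uniformity_circle_def)
  show "open U \<longleftrightarrow> (\<forall>x\<in>U. \<forall>\<^sub>F (x', y) in uniformity. x' = x \<longrightarrow> y \<in> U)" for U :: "circle set"
    by (rule open_circle_def)
  fix p q r :: circle
  obtain x where x: "abs_circle x = p" by (metis abs_circle_cases)
  obtain y where y: "abs_circle y = q" "dist p q = \<bar>x - y\<bar>" using attained[OF x] by blast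
  show "dist p q = 0 \<longleftrightarrow> p = q"
    using x y le[of x p x p] by (auto simp: dist_circle_def)
  obtain z where z: "abs_circle z = r" "dist p r = \<bar>x - z\<bar>" using attained[OF x] by blast
  obtain w where w: "abs_circle w = q" "dist r q = \<bar>z - w\<bar>" using attained[OF z(1)] by blast
  show "dist p q \<le> dist p r + dist q r"
    using le[OF x w(1)] z(2) w(2) sym[of q r] by linarith
qed

end

text \<open>
  The derivative of a circle-valued curve is the derivative of a real-valued angle function
  representing it. The lift is only required to be differentiable at \<open>t\<close> (hence continuous there),
  which determines it near \<open>t\<close> up to a constant in \<open>2\<pi>\<int>\<close>; elsewhere it may jump, so nothing
  beyond local behaviour at \<open>t\<close> is asserted.
\<close>

definition has_circle_derivative :: "(real \<Rightarrow> circle) \<Rightarrow> real \<Rightarrow> real \<Rightarrow> real set \<Rightarrow> bool" where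
  "has_circle_derivative \<theta> v t S \<longleftrightarrow>
     (\<exists>\<phi>. (\<forall>s\<in>S. abs_circle (\<phi> s) = \<theta> s) \<and> (\<phi> has_real_derivative v) (at t within S))"

section \<open>Absolutely continuous curves\<close>

text \<open>
  A finite family of intervals is given by its endpoints \<open>a i \<le> b i\<close>, \<open>i < n\<close>;
  degenerate intervals contribute nothing to either sum.
\<close>

definition absolutely_continuous_curve :: "real \<Rightarrow> real \<Rightarrow> (real \<Rightarrow> 'a::metric_space) \<Rightarrow> bool" where
  "absolutely_continuous_curve c d f \<longleftrightarrow>
     (\<forall>\<epsilon>>0. \<exists>\<delta>>0. \<forall>(n::nat) a b.
        (\<forall>i<n. c \<le> a i \<and> a i \<le> b i \<and> b i \<le> d) \<and>
        disjoint_family_on (\<lambda>i. {a i<..<b i}) {..<n} \<and>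
        (\<Sum>i<n. b i - a i) < \<delta> \<longrightarrow>
        (\<Sum>i<n. dist (f (a i)) (f (b i))) < \<epsilon>)"

section \<open>The control system\<close>

type_synonym config = "real \<times> real \<times> circle"

text \<open>Controls are represented by functions rather than classes modulo null sets.\<close>

definition admissible_control :: "real \<Rightarrow> (real \<Rightarrow> real) \<Rightarrow> bool" where
  "admissible_control t\<^sub>1 u \<longleftrightarrow>
     u \<in> borel_measurable (lebesgue_on {0..t\<^sub>1}) \<and>
     integrable (lebesgue_on {0..t\<^sub>1}) (\<lambda>t. (u t)\<^sup>2)"

definition trajectory :: "real \<Rightarrow> (real \<Rightarrow> real) \<Rightarrow> (real \<Rightarrow> config) \<Rightarrow> bool" where
  "trajectory t\<^sub>1 u q \<longleftrightarrow>
     absolutely_continuous_curve 0 t\<^sub>1 q \<and>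
     (let x = (\<lambda>t. fst (q t)); y = (\<lambda>t. fst (snd (q t))); \<theta> = (\<lambda>t. snd (snd (q t))) in
      AE t in lebesgue_on {0..t\<^sub>1}.
        (x has_real_derivative cos_circle (\<theta> t)) (at t within {0..t\<^sub>1}) \<and>
        (y has_real_derivative sin_circle (\<theta> t)) (at t within {0..t\<^sub>1}) \<and>
        has_circle_derivative \<theta> (u t) t {0..t\<^sub>1})"

definition attainable_set :: "config \<Rightarrow> real \<Rightarrow> config set" where
  "attainable_set q\<^sub>0 t\<^sub>1 =
     {q t\<^sub>1 | q u. admissible_control t\<^sub>1 u \<and> trajectory t\<^sub>1 u q \<and> q 0 = q\<^sub>0}"

end

theory Submission
  imports Defs
begin

text \<open>
  The car moves at unit speed and is steered by its angular velocity. In time \<open>t\<^sub>1\<close> it cannot get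
  farther than \<open>t\<^sub>1\<close>, and it gets exactly that far only along a straight line, with its heading
  constantly equal to the direction of the line (\<open>trajectory_endpoint_cases\<close>). As the velocity
  is only known for almost every time, this rests on the fact that an absolutely
  continuous function whose derivative is nonnegative almost everywhere is nondecreasing
  (\<open>absolutely_continuous_nonneg_derivative_imp_le\<close>), applied to the elapsed time minus the progress
  in the direction of the final displacement.

  Conversely, the one boundary point is reached with zero control. Let the final position lie in the open disc of radius \<open>t\<^sub>1\<close>. Since the angular velocity
  is unbounded, the car can change its heading arbitrarily within any positive time, and it can do so
  without net displacement (\<open>steerable_in_place\<close>): it spins to the required heading through at least
  two full turns, interrupted at one heading by a straight piece just long enough to cancel the
  displacement caused by the spin. So it can spin towards the target, drive straight to it, and use up the
  remaining time by spinning to the required final heading (\<open>steerable_disc\<close>). These paths are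
  concatenations of circular arcs and line segments, and their controls are step functions.
\<close>

section \<open>Absolutely continuous functions with nonnegative derivative\<close>

text \<open>
  One estimate serves twice: with \<open>B = 0\<close> it says that Lipschitz curves are absolutely
  continuous, and with \<open>A = 1\<close> it transfers absolute continuity from a trajectory to a
  real-valued function of time and position.
\<close>

lemma absolutely_continuous_curve_dominated:
  assumes ac: "absolutely_continuous_curve a b q"
    and le: "\<And>s t. s \<in> {a..b} \<Longrightarrow> t \<in> {a..b} \<Longrightarrow> dist (g s) (g t) \<le> A * \<bar>s - t\<bar> + B * dist (q s) (q t)"
  shows "absolutely_continuous_curve a b g"
  unfolding absolutely_continuous_curve_def
proof (intro allI impI)
  fix e :: real assume e: "e > 0"
  define C where "C = 1 + \<bar>A\<bar> + \<bar>B\<bar>"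
  have C: "C > 0" "A \<le> C" "B \<le> C" by (auto simp: C_def)
  from e C have "e / (2 * C) > 0" by simp
  from ac[unfolded absolutely_continuous_curve_def, rule_format, OF this]
  obtain d where d: "d > 0" and D: "\<And>(n::nat) l r. (\<forall>i<n. a \<le> l i \<and> l i \<le> r i \<and> r i \<le> b) \<and>
      disjoint_family_on (\<lambda>i. {l i<..<r i}) {..<n} \<and> (\<Sum>i<n. r i - l i) < d \<Longrightarrow>
      (\<Sum>i<n. dist (q (l i)) (q (r i))) < e / (2 * C)"
    by blast
  show "\<exists>\<delta>>0. \<forall>(n::nat) l r. (\<forall>i<n. a \<le> l i \<and> l i \<le> r i \<and> r i \<le> b) \<and>
      disjoint_family_on (\<lambda>i. {l i<..<r i}) {..<n} \<and> (\<Sum>i<n. r i - l i) < \<delta> \<longrightarrow>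
      (\<Sum>i<n. dist (g (l i)) (g (r i))) < e"
  proof (intro exI[of _ "min d (e / (2 * C))"] conjI allI impI)
    fix n :: nat and l r :: "nat \<Rightarrow> real"
    assume H: "(\<forall>i<n. a \<le> l i \<and> l i \<le> r i \<and> r i \<le> b) \<and>
      disjoint_family_on (\<lambda>i. {l i<..<r i}) {..<n} \<and> (\<Sum>i<n. r i - l i) < min d (e / (2 * C))"
    have "(\<Sum>i<n. dist (g (l i)) (g (r i))) \<le> (\<Sum>i<n. C * (r i - l i) + C * dist (q (l i)) (q (r i)))"
    proof (rule sum_mono)
      fix i assume i: "i \<in> {..<n}"
      with H have lr: "a \<le> l i" "l i \<le> r i" "r i \<le> b" by auto
      then have "dist (g (l i)) (g (r i)) \<le> A * \<bar>l i - r i\<bar> + B * dist (q (l i)) (q (r i))"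
        by (intro le) auto
      also have "\<dots> \<le> C * (r i - l i) + C * dist (q (l i)) (q (r i))"
        using lr C by (intro add_mono) (auto intro: mult_right_mono)
      finally show "dist (g (l i)) (g (r i)) \<le> C * (r i - l i) + C * dist (q (l i)) (q (r i))" .
    qed
    also have "\<dots> = C * ((\<Sum>i<n. r i - l i) + (\<Sum>i<n. dist (q (l i)) (q (r i))))"
      by (simp add: sum.distrib sum_distrib_left distrib_left)
    also have "\<dots> < C * (e / (2 * C) + e / (2 * C))"
      using H D[of n l r] C by (intro mult_strict_left_mono add_strict_mono) auto
    also have "\<dots> = e" using C by simp
    finally show "(\<Sum>i<n. dist (g (l i)) (g (r i))) < e" .
  qed (use d e C in auto)
qed

lemma absolutely_continuous_curve_subinterval:
  assumes ac: "absolutely_continuous_curve a b f" and sub: "a \<le> c" "d \<le> b"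
  shows "absolutely_continuous_curve c d f"
  unfolding absolutely_continuous_curve_def
proof (intro allI impI)
  fix e :: real assume "e > 0"
  with ac obtain \<delta> where \<delta>: "\<delta> > 0" and D: "\<And>(n::nat) l r. (\<forall>i<n. a \<le> l i \<and> l i \<le> r i \<and> r i \<le> b) \<and>
      disjoint_family_on (\<lambda>i. {l i<..<r i}) {..<n} \<and> (\<Sum>i<n. r i - l i) < \<delta> \<Longrightarrow>
      (\<Sum>i<n. dist (f (l i)) (f (r i))) < e"
    unfolding absolutely_continuous_curve_def by blast
  show "\<exists>\<delta>>0. \<forall>(n::nat) l r. (\<forall>i<n. c \<le> l i \<and> l i \<le> r i \<and> r i \<le> d) \<and>
      disjoint_family_on (\<lambda>i. {l i<..<r i}) {..<n} \<and> (\<Sum>i<n. r i - l i) < \<delta> \<longrightarrow>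
      (\<Sum>i<n. dist (f (l i)) (f (r i))) < e"
    using \<delta> sub by (intro exI[of _ \<delta>] conjI allI impI D) (auto intro: order_trans)
qed

lemma absolutely_continuous_curve_imp_continuous_on:
  assumes "absolutely_continuous_curve a b f"
  shows "continuous_on {a..b} f"
  unfolding continuous_on_iff
proof (intro ballI allI impI)
  fix x e :: real assume x: "x \<in> {a..b}" and "e > 0"
  with assms obtain d where d: "d > 0" and D: "\<And>(n::nat) l r. (\<forall>i<n. a \<le> l i \<and> l i \<le> r i \<and> r i \<le> b) \<and>
      disjoint_family_on (\<lambda>i. {l i<..<r i}) {..<n} \<and> (\<Sum>i<n. r i - l i) < d \<Longrightarrow>
      (\<Sum>i<n. dist (f (l i)) (f (r i))) < e"
    unfolding absolutely_continuous_curve_def by blast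
  have "dist (f y) (f x) < e" if "y \<in> {a..b}" "dist y x < d" for y
    using D[of 1 "\<lambda>_. min x y" "\<lambda>_. max x y"] that x
    by (cases "x \<le> y") (auto simp: disjoint_family_on_def dist_real_def dist_commute)
  with d show "\<exists>d>0. \<forall>x'\<in>{a..b}. dist x' x < d \<longrightarrow> dist (f x') (f x) < e" by blast
qed

text \<open>
  The first-order expansion at \<open>x\<close> is used once to the left and once to the right of \<open>x\<close>. The
  linear terms have the favourable sign since \<open>D \<ge> 0\<close>, and the two errors, at most \<open>e * (x - u)\<close>
  and \<open>e * (v - x)\<close>, add up exactly to \<open>e * (v - u)\<close>.
\<close>

lemma nonneg_derivative_straddle:
  fixes f :: "real \<Rightarrow> real"
  assumes "(f has_real_derivative D) (at x within S)" "D \<ge> 0" "e > 0"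
  obtains d where "d > 0"
    "\<And>u v. u \<in> S \<Longrightarrow> v \<in> S \<Longrightarrow> u \<le> x \<Longrightarrow> x \<le> v \<Longrightarrow> x - u < d \<Longrightarrow> v - x < d \<Longrightarrow> f u - f v \<le> e * (v - u)"
proof -
  from assms(1,3) obtain d where d: "d > 0"
    and B: "\<And>y. y \<in> S \<Longrightarrow> \<bar>y - x\<bar> < d \<Longrightarrow> \<bar>f y - f x - D * (y - x)\<bar> \<le> e * \<bar>y - x\<bar>"
    unfolding has_field_derivative_def has_derivative_within_alt real_norm_def by blast
  show thesis
  proof (rule that[OF d])
    fix u v assume H: "u \<in> S" "v \<in> S" "u \<le> x" "x \<le> v" "x - u < d" "v - x < d"
    from B[of u] B[of v] H have "f u - f x - D * (u - x) \<le> e * (x - u)" "-(e * (v - x)) \<le> f v - f x - D * (v - x)"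
      by auto
    moreover have "D * (u - x) \<le> 0" "0 \<le> D * (v - x)"
      using H assms(2) by (auto simp: mult_nonneg_nonpos)
    ultimately show "f u - f v \<le> e * (v - u)" by (simp add: algebra_simps)
  qed
qed

lemma negligible_outer_open:
  fixes N :: "real set"
  assumes "negligible N" "e > 0"
  obtains U where "open U" "N \<subseteq> U" "U \<in> lmeasurable" "measure lebesgue U < e"
proof -
  have N: "N \<in> null_sets lebesgue" using assms(1) by (simp add: negligible_iff_null_sets)
  then obtain U where U: "open U" "N \<subseteq> U" "U - N \<in> lmeasurable" "emeasure lebesgue (U - N) < ennreal e"
    using sets_lebesgue_outer_open[OF _ assms(2), of N] by blast
  have m: "U \<in> sets lebesgue" using U(1) by auto
  have "emeasure lebesgue U < ennreal e"
    using U(4) emeasure_Diff_null_set[OF N m] by simp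
  moreover from this have lm: "U \<in> lmeasurable"
    using m by (intro fmeasurableI) (auto intro: less_trans)
  ultimately have "measure lebesgue U < e"
    by (simp add: emeasure_eq_measure2 ennreal_less_iff)
  with U lm that show thesis by blast
qed

text \<open>
  The exceptional set \<open>N\<close> lies in an open set \<open>U\<close> of measure below the \<open>\<delta>\<close> of absolute continuity.
  Take a tagged division of \<open>{a..b}\<close> so fine that a piece with tag in \<open>N\<close> lies in \<open>U\<close>, while a piece
  with tag outside \<open>N\<close> is short enough for the straddle estimate at its tag. The pieces of the
  first kind have total length below \<open>\<delta>\<close>, so \<open>f\<close> decreases by at most \<open>e\<close> on them together; on
  those of the second kind it decreases by at most \<open>e * (b - a)\<close>. The increments add up to
  \<open>f b - f a\<close>, and \<open>e\<close> is arbitrary.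
\<close>

lemma absolutely_continuous_nonneg_derivative_imp_le:
  fixes f :: "real \<Rightarrow> real"
  assumes ac: "absolutely_continuous_curve a b f" and "a \<le> b" and N: "negligible N"
    and deriv: "\<And>t. t \<in> {a..b} - N \<Longrightarrow> \<exists>D\<ge>0. (f has_real_derivative D) (at t within {a..b})"
  shows "f a \<le> f b"
proof -
  have bound: "f a - f b \<le> e * (b - a) + e" if e: "e > 0" for e
  proof -
    from ac e obtain \<delta> where \<delta>: "\<delta> > 0" and D: "\<And>(n::nat) l r. (\<forall>i<n. a \<le> l i \<and> l i \<le> r i \<and> r i \<le> b) \<and>
        disjoint_family_on (\<lambda>i. {l i<..<r i}) {..<n} \<and> (\<Sum>i<n. r i - l i) < \<delta> \<Longrightarrow>
        (\<Sum>i<n. dist (f (l i)) (f (r i))) < e"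
      unfolding absolutely_continuous_curve_def by blast
    from negligible_outer_open[OF N \<delta>]
    obtain U where U: "open U" "N \<subseteq> U" "U \<in> lmeasurable" "measure lebesgue U < \<delta>" by blast
    have "\<exists>d>0. \<forall>u\<in>{a..b}. \<forall>v\<in>{a..b}. u \<le> x \<longrightarrow> x \<le> v \<longrightarrow> x - u < d \<longrightarrow> v - x < d \<longrightarrow>
        f u - f v \<le> e * (v - u)" if "x \<in> {a..b} - N" for x
      using deriv[OF that] nonneg_derivative_straddle[OF _ _ e, of f _ x "{a..b}"] by metis
    then obtain \<rho> where \<rho>: "\<And>x. x \<in> {a..b} - N \<Longrightarrow> \<rho> x > 0"
      "\<And>x u v. x \<in> {a..b} - N \<Longrightarrow> u \<in> {a..b} \<Longrightarrow> v \<in> {a..b} \<Longrightarrow> u \<le> x \<Longrightarrow> x \<le> v \<Longrightarrow>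
        x - u < \<rho> x \<Longrightarrow> v - x < \<rho> x \<Longrightarrow> f u - f v \<le> e * (v - u)"
      by metis
    define \<gamma> where "\<gamma> x = (if x \<in> N then U else ball x (if x \<in> {a..b} then \<rho> x else 1))" for x
    have "gauge \<gamma>"
      using U \<rho>(1) by (auto simp: gauge_def \<gamma>_def)
    then obtain p where p: "p tagged_division_of {a..b}" "\<gamma> fine p"
      by (rule fine_division_exists_real)
    note pD = tagged_division_ofD[OF p(1)]
    have ivl: "K = {Inf K..Sup K}" "Inf K \<le> x" "x \<le> Sup K" "Inf K \<in> {a..b}" "Sup K \<in> {a..b}"
      "K \<subseteq> \<gamma> x" "x \<in> {a..b}" if xK: "(x, K) \<in> p" for x K
    proof -
      obtain u v where K: "K = {u..v}" using pD(4)[OF xK] by auto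
      have x: "x \<in> K" "K \<subseteq> {a..b}" using pD(2,3)[OF xK] by auto
      with K have "u \<le> v" by auto
      with K x show "K = {Inf K..Sup K}" "Inf K \<le> x" "x \<le> Sup K" "Inf K \<in> {a..b}" "Sup K \<in> {a..b}" "x \<in> {a..b}"
        by auto
      show "K \<subseteq> \<gamma> x" using p(2) xK by (auto simp: fine_def)
    qed
    define P where "P = {xK \<in> p. fst xK \<in> N}"
    have fin: "finite p" "finite P" "P \<subseteq> p" using pD(1) by (auto simp: P_def)
    let ?g = "\<lambda>(x, K). f (Inf K) - f (Sup K)"
    have good: "sum ?g (p - P) \<le> e * (b - a)"
    proof -
      have "sum ?g (p - P) \<le> (\<Sum>(x, K)\<in>p - P. e * (Sup K - Inf K))"
      proof (rule sum_mono, clarify)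
        fix x K assume H: "(x, K) \<in> p" "(x, K) \<notin> P"
        note i = ivl[OF H(1)]
        have x: "x \<in> {a..b} - N" using H i by (auto simp: P_def)
        then have "K \<subseteq> ball x (\<rho> x)" using i(6) by (auto simp: \<gamma>_def)
        moreover have "Inf K \<in> K" "Sup K \<in> K" using i(1-3) by (metis atLeastAtMost_iff order_refl order_trans)+
        ultimately have "x - Inf K < \<rho> x" "Sup K - x < \<rho> x"
          by (auto simp: dist_real_def)
        with i x show "f (Inf K) - f (Sup K) \<le> e * (Sup K - Inf K)" by (intro \<rho>(2)[of x]) auto
      qed
      also have "\<dots> \<le> (\<Sum>(x, K)\<in>p. e * (Sup K - Inf K))"
        using fin e order_trans[OF ivl(2,3)] by (intro sum_mono2) auto
      also have "\<dots> = e * (\<Sum>(x, K)\<in>p. Sup K - Inf K)"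
        by (simp add: sum_distrib_left case_prod_unfold)
      also have "(\<Sum>(x, K)\<in>p. Sup K - Inf K) = b - a"
        using additive_tagged_division_1[OF \<open>a \<le> b\<close> p(1), of "\<lambda>x. x"] by simp
      finally show ?thesis .
    qed
    have bad: "sum ?g P \<le> e"
    proof -
      \<comment> \<open>Absolute continuity speaks of families indexed by an initial segment of the naturals.\<close>
      obtain h n where h: "bij_betw h {..<n::nat} P"
        using ex_bij_betw_nat_finite[OF fin(2)] by (auto simp: atLeast0LessThan)
      define l r where "l i = Inf (snd (h i))" and "r i = Sup (snd (h i))" for i
      have hP: "h i \<in> P" if "i < n" for i using h that by (auto simp: bij_betw_def)
      have hi: "a \<le> l i" "l i \<le> r i" "r i \<le> b" "{l i<..<r i} \<subseteq> U" "interior (snd (h i)) = {l i<..<r i}"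
        if "i < n" for i
      proof -
        obtain x K where xK: "h i = (x, K)" "(x, K) \<in> p" "x \<in> N"
          using hP[OF \<open>i < n\<close>] by (cases "h i") (auto simp: P_def)
        note i = ivl[OF xK(2)]
        show "a \<le> l i" "l i \<le> r i" "r i \<le> b" using i xK by (auto simp: l_def r_def)
        have K: "K = {l i..r i}" using i(1) xK by (simp add: l_def r_def)
        then show "{l i<..<r i} \<subseteq> U" using i(6) xK by (auto simp: \<gamma>_def)
        show "interior (snd (h i)) = {l i<..<r i}" using K xK by simp
      qed
      have disj: "disjoint_family_on (\<lambda>i. {l i<..<r i}) {..<n}"
        unfolding disjoint_family_on_def
      proof (intro ballI impI)
        fix i j assume ij: "i \<in> {..<n}" "j \<in> {..<n}" "i \<noteq> j"
        then have "h i \<noteq> h j" using h by (auto simp: bij_betw_def inj_on_def)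
        moreover have "h i \<in> p" "h j \<in> p" using hP ij fin(3) by auto
        ultimately have "interior (snd (h i)) \<inter> interior (snd (h j)) = {}"
          using pD(5) by (metis prod.collapse)
        then show "{l i<..<r i} \<inter> {l j<..<r j} = {}" using hi(5) ij by auto
      qed
      have "(\<Sum>i<n. r i - l i) = (\<Sum>i<n. measure lebesgue {l i<..<r i})"
        using hi by (intro sum.cong) auto
      also have "\<dots> = measure lebesgue (\<Union>i<n. {l i<..<r i})"
        using disj by (intro measure_UNION'[symmetric])
          (auto simp: disjoint_family_on_def pairwise_def disjnt_def)
      also have "\<dots> \<le> measure lebesgue U"
        using U hi(4) by (intro measure_mono_fmeasurable UN_least) (auto intro!: sets.finite_UN)
      finally have "(\<Sum>i<n. r i - l i) < \<delta>" using U by simp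
      then have small: "(\<Sum>i<n. dist (f (l i)) (f (r i))) < e"
        using disj hi by (intro D) auto
      have "sum ?g P = (\<Sum>i<n. ?g (h i))"
        by (rule sum.reindex_bij_betw[OF h, symmetric])
      also have "\<dots> \<le> (\<Sum>i<n. dist (f (l i)) (f (r i)))"
        by (intro sum_mono) (auto simp: l_def r_def case_prod_unfold dist_real_def)
      finally show ?thesis using small by simp
    qed
    have "f a - f b = sum ?g p"
      using additive_tagged_division_1[OF \<open>a \<le> b\<close> p(1), of "\<lambda>x. - f x"] by simp
    also have "\<dots> = sum ?g (p - P) + sum ?g P"
      using sum.subset_diff[OF fin(3,1)] .
    finally show ?thesis using good bad by simp
  qed
  show ?thesis
  proof (rule ccontr)
    assume "\<not> f a \<le> f b"
    then have pos: "f a - f b > 0" by simp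
    define e where "e = (f a - f b) / (2 * (b - a + 1))"
    have "e > 0" using pos \<open>a \<le> b\<close> by (simp add: e_def)
    from bound[OF this] have "f a - f b \<le> e * (b - a + 1)" by (simp add: algebra_simps)
    also have "\<dots> = (f a - f b) / 2"
    proof -
      have "b - a + 1 \<noteq> 0" using \<open>a \<le> b\<close> by simp
      then show ?thesis unfolding e_def by (metis nonzero_mult_divide_mult_cancel_right times_divide_eq_left)
    qed
    finally show False using pos by simp
  qed
qed

section \<open>The reachable distance\<close>

text \<open>
  Let the displacement have polar form \<open>r\<close>, \<open>\<psi>\<close>. The function \<open>g t\<close> is the time elapsed minus the
  progress made in the direction \<open>\<psi>\<close>; its derivative is almost everywhere \<open>1 - cos (\<theta> - \<psi>) \<ge> 0\<close>, so
  it is nondecreasing, from \<open>0\<close> to \<open>T - r\<close>, and \<open>r \<le> T\<close>. If \<open>r = T\<close> then \<open>g\<close> vanishes identically, which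
  forces \<open>\<theta> = \<psi>\<close> almost everywhere, hence everywhere by continuity: the trajectory is a straight
  line, and \<open>\<psi>\<close> is both its initial and its final angle.
\<close>

lemma trajectory_endpoint_cases:
  assumes T: "T > 0" and traj: "trajectory T u q" and q0: "q 0 = (x\<^sub>0, y\<^sub>0, \<theta>\<^sub>0)" and qT: "q T = (x, y, \<theta>)"
  shows "(x - x\<^sub>0)\<^sup>2 + (y - y\<^sub>0)\<^sup>2 < T\<^sup>2 \<or>
    (x, y, \<theta>) = (x\<^sub>0 + T * cos_circle \<theta>\<^sub>0, y\<^sub>0 + T * sin_circle \<theta>\<^sub>0, \<theta>\<^sub>0)"
proof -
  define X where "X t = fst (q t)" for t
  define Y where "Y t = fst (snd (q t))" for t
  define \<Theta> where "\<Theta> t = snd (snd (q t))" for t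
  have ac: "absolutely_continuous_curve 0 T q"
    using traj by (simp add: trajectory_def Let_def)
  have "AE t in lebesgue_on {0..T}.
      (X has_real_derivative cos_circle (\<Theta> t)) (at t within {0..T}) \<and>
      (Y has_real_derivative sin_circle (\<Theta> t)) (at t within {0..T})"
    using traj unfolding trajectory_def Let_def X_def Y_def \<Theta>_def by auto
  then have "AE t in lebesgue. t \<in> {0..T} \<longrightarrow>
      (X has_real_derivative cos_circle (\<Theta> t)) (at t within {0..T}) \<and>
      (Y has_real_derivative sin_circle (\<Theta> t)) (at t within {0..T})"
    by (subst (asm) AE_restrict_space_iff) auto
  then obtain N where N: "negligible N"
    and d: "\<And>t. t \<in> {0..T} - N \<Longrightarrow> (X has_real_derivative cos_circle (\<Theta> t)) (at t within {0..T})"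
      "\<And>t. t \<in> {0..T} - N \<Longrightarrow> (Y has_real_derivative sin_circle (\<Theta> t)) (at t within {0..T})"
    unfolding eventually_ae_filter_negligible by blast
  have ends: "X 0 = x\<^sub>0" "Y 0 = y\<^sub>0" "\<Theta> 0 = \<theta>\<^sub>0" "X T = x" "Y T = y" "\<Theta> T = \<theta>"
    using q0 qT by (auto simp: X_def Y_def \<Theta>_def)
  define w where "w = Complex (x - x\<^sub>0) (y - y\<^sub>0)"
  define r where "r = cmod w"
  define \<psi> where "\<psi> = Arg w"
  have "rcis r \<psi> = w" by (simp add: r_def \<psi>_def rcis_cmod_Arg)
  then have xy: "x = x\<^sub>0 + r * cos \<psi>" "y = y\<^sub>0 + r * sin \<psi>"
    by (auto simp: w_def complex_eq_iff)
  have r2: "(x - x\<^sub>0)\<^sup>2 + (y - y\<^sub>0)\<^sup>2 = r\<^sup>2"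
    by (simp add: r_def w_def cmod_power2)
  have "r \<ge> 0" by (simp add: r_def)
  define g where "g t = t - (X t - x\<^sub>0) * cos \<psi> - (Y t - y\<^sub>0) * sin \<psi>" for t
  \<comment> \<open>The cosine of the angle between the heading and the displacement.\<close>
  define e where "e t = cos_circle (\<Theta> t) * cos \<psi> + sin_circle (\<Theta> t) * sin \<psi>" for t
  have e: "e t = cos (a - \<psi>)" if "\<Theta> t = abs_circle a" for t a
    by (simp add: e_def that cos_circle.abs_eq sin_circle.abs_eq cos_diff)
  have e1: "e t \<le> 1" for t
    by (cases "\<Theta> t" rule: abs_circle_cases) (simp add: e)
  have gd: "(g has_real_derivative 1 - e t) (at t within {0..T})" if "t \<in> {0..T} - N" for t
    unfolding g_def e_def using d[OF that] by (auto intro!: derivative_eq_intros)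
  have gac: "absolutely_continuous_curve 0 T g"
  proof (rule absolutely_continuous_curve_dominated[OF ac])
    fix s t :: real
    have "dist (X s) (X t) \<le> dist (q s) (q t)" unfolding X_def by (rule dist_fst_le)
    moreover have "dist (Y s) (Y t) \<le> dist (q s) (q t)"
      unfolding Y_def by (rule order_trans[OF dist_fst_le dist_snd_le])
    moreover have "\<bar>(X s - X t) * cos \<psi>\<bar> \<le> \<bar>X s - X t\<bar>" "\<bar>(Y s - Y t) * sin \<psi>\<bar> \<le> \<bar>Y s - Y t\<bar>"
      by (auto simp: abs_mult intro!: mult_left_le)
    moreover have "g s - g t = (s - t) - (X s - X t) * cos \<psi> - (Y s - Y t) * sin \<psi>"
      by (simp add: g_def algebra_simps)
    ultimately show "dist (g s) (g t) \<le> 1 * \<bar>s - t\<bar> + 2 * dist (q s) (q t)"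
      by (simp add: dist_real_def)
  qed
  have mono: "g s \<le> g t" if st: "0 \<le> s" "s \<le> t" "t \<le> T" for s t
  proof (rule absolutely_continuous_nonneg_derivative_imp_le[OF _ st(2) N])
    show "absolutely_continuous_curve s t g"
      using absolutely_continuous_curve_subinterval[OF gac] st by auto
    show "\<exists>D\<ge>0. (g has_real_derivative D) (at \<tau> within {s..t})" if "\<tau> \<in> {s..t} - N" for \<tau>
      using DERIV_subset[OF gd[of \<tau>], of "{s..t}"] that st e1[of \<tau>]
      by (intro exI[of _ "1 - e \<tau>"]) auto
  qed
  have g0: "g 0 = 0" by (simp add: g_def ends)
  have "g T = T - r * ((cos \<psi>)\<^sup>2 + (sin \<psi>)\<^sup>2)"
    unfolding g_def ends xy by algebra
  then have gT: "g T = T - r" by simp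
  have "r \<le> T" using mono[of 0 T] T g0 gT by simp
  show ?thesis
  proof (cases "r < T")
    case True
    then show ?thesis using r2 \<open>r \<ge> 0\<close> by (simp add: power_strict_mono)
  next
    case False
    with \<open>r \<le> T\<close> have rT: "r = T" by simp
    have g: "g t = 0" if "t \<in> {0..T}" for t
      using mono[of 0 t] mono[of t T] that g0 gT rT by simp
    have off: "\<Theta> t = abs_circle \<psi>" if t: "t \<in> {0<..<T} - N" for t
    proof -
      obtain a where a: "\<Theta> t = abs_circle a" by (rule abs_circle_cases)
      have "(g has_real_derivative 1 - e t) (at t)"
        using gd[of t] t at_within_Icc_at[of 0 t T] by auto
      moreover have "(g has_real_derivative 0) (at t)"
        by (rule has_field_derivative_transform_within_open[OF DERIV_const[of 0], of "{0<..<T}"])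
          (use t g in auto)
      ultimately have "cos (a - \<psi>) = 1" using DERIV_unique e[OF a] by fastforce
      then obtain n :: int where "a - \<psi> = n * 2 * pi" by (auto simp: cos_one_2pi_int)
      then have "a = \<psi> + of_int n * (2 * pi)" by simp
      then show ?thesis using a abs_circle_eq_iff by metis
    qed
    have cont: "continuous_on {0..T} q"
      using ac by (rule absolutely_continuous_curve_imp_continuous_on)
    have all: "\<Theta> t = abs_circle \<psi>" if t: "t \<in> {0..T}" for t
    proof (rule ccontr)
      assume "\<Theta> t \<noteq> abs_circle \<psi>"
      then have "dist (\<Theta> t) (abs_circle \<psi>) > 0" by simp
      with cont t obtain \<delta> where \<delta>: "\<delta> > 0"
        "\<And>s. s \<in> {0..T} \<Longrightarrow> dist s t < \<delta> \<Longrightarrow> dist (q s) (q t) < dist (\<Theta> t) (abs_circle \<psi>)"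
        unfolding continuous_on_iff by metis
      \<comment> \<open>Near \<open>t\<close> the heading differs from \<open>\<psi>\<close>, so a nonempty open interval would be a null set.\<close>
      let ?I = "{max 0 (t - \<delta>)<..<min T (t + \<delta>)}"
      have "?I \<subseteq> N"
      proof
        fix s assume s: "s \<in> ?I"
        have "dist (\<Theta> s) (\<Theta> t) \<le> dist (q s) (q t)"
          unfolding \<Theta>_def by (rule order_trans[OF dist_snd_le dist_snd_le])
        also have "\<dots> < dist (\<Theta> t) (abs_circle \<psi>)"
          using s by (intro \<delta>(2)) (auto simp: dist_real_def)
        finally have "\<Theta> s \<noteq> abs_circle \<psi>" by (auto simp: dist_commute)
        then show "s \<in> N" using off[of s] s by auto
      qed
      then have "negligible ?I" using N negligible_subset by blast
      moreover have "?I \<noteq> {}" using t T \<delta>(1) by auto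
      ultimately show False using open_not_negligible[of ?I] by simp
    qed
    show ?thesis
      using all[of 0] all[of T] T xy rT ends by (simp add: cos_circle.abs_eq sin_circle.abs_eq)
  qed
qed


section \<open>Concatenating arcs and segments\<close>

text \<open>
  In \<open>steerable T \<alpha> \<beta> w\<close> a lifted angle goes from \<open>\<alpha>\<close> to \<open>\<beta>\<close> in time \<open>T\<close> while the position,
  written as a complex number, is displaced by \<open>w\<close>. Working with real angles and Lipschitz curves
  whose derivatives may fail to exist at finitely many times makes concatenation easy.
\<close>

definition steerable :: "real \<Rightarrow> real \<Rightarrow> real \<Rightarrow> complex \<Rightarrow> bool" where
  "steerable T \<alpha> \<beta> w \<longleftrightarrow> 0 \<le> T \<and> (\<exists>\<phi> z u L S.
     \<phi> 0 = \<alpha> \<and> \<phi> T = \<beta> \<and> z 0 = 0 \<and> z T = w \<and>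
     L-lipschitz_on {0..T} \<phi> \<and> 1-lipschitz_on {0..T} z \<and>
     u \<in> borel_measurable borel \<and> (\<forall>t. \<bar>u t\<bar> \<le> L) \<and> finite S \<and>
     (\<forall>t\<in>{0<..<T} - S. (\<phi> has_real_derivative u t) (at t) \<and> (z has_vector_derivative cis (\<phi> t)) (at t)))"

lemma steerable_smooth:
  assumes T: "0 \<le> T"
    and \<phi>: "\<And>t. (\<phi> has_real_derivative c) (at t)"
    and z: "\<And>t. (z has_vector_derivative cis (\<phi> t)) (at t)" "z 0 = 0"
  shows "steerable T (\<phi> 0) (\<phi> T) (z T)"
proof -
  have "\<bar>c\<bar>-lipschitz_on {0..T} \<phi>"
    using \<phi> by (intro bounded_derivative_imp_lipschitz[where f' = "\<lambda>_. (*) c"])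
      (auto simp: has_field_derivative_def abs_mult intro: has_derivative_at_withinI intro!: onorm_bound)
  moreover have "1-lipschitz_on {0..T} z"
    using z(1) by (intro bounded_derivative_imp_lipschitz[where f' = "\<lambda>t x. x *\<^sub>R cis (\<phi> t)"])
      (auto simp: has_vector_derivative_def intro: has_derivative_at_withinI intro!: onorm_bound)
  ultimately show ?thesis
    unfolding steerable_def using assms
    by (intro conjI exI[of _ \<phi>] exI[of _ z] exI[of _ "\<lambda>_. c"] exI[of _ "\<bar>c\<bar>"] exI[of _ "{}"]) auto
qed

lemma steerable_straight:
  assumes "0 \<le> T"
  shows "steerable T \<alpha> \<alpha> (of_real T * cis \<alpha>)"
proof -
  have "((\<lambda>t. of_real t * cis \<alpha>) has_vector_derivative cis \<alpha>) (at t)" for t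
    by (auto intro!: derivative_eq_intros)
  from steerable_smooth[OF assms, of "\<lambda>_. \<alpha>" 0, OF _ this] show ?thesis by simp
qed

lemma steerable_turn:
  assumes "0 \<le> T" "\<omega> \<noteq> 0"
  shows "steerable T \<alpha> (\<alpha> + \<omega> * T) ((cis (\<alpha> + \<omega> * T) - cis \<alpha>) / (\<i> * of_real \<omega>))"
proof -
  let ?z = "\<lambda>t. (cis (\<alpha> + \<omega> * t) - cis \<alpha>) / (\<i> * of_real \<omega>)"
  have "(?z has_vector_derivative cis (\<alpha> + \<omega> * t)) (at t)" for t
  proof -
    have "((\<lambda>t. cis (\<alpha> + \<omega> * t)) has_vector_derivative \<omega> *\<^sub>R (\<i> * cis (\<alpha> + \<omega> * t))) (at t)"
      unfolding has_vector_derivative_def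
      by (auto intro!: derivative_eq_intros simp: scaleR_conv_of_real)
    then have "((\<lambda>t. cis (\<alpha> + \<omega> * t) - cis \<alpha>) has_vector_derivative
        \<omega> *\<^sub>R (\<i> * cis (\<alpha> + \<omega> * t))) (at t)"
      by (auto intro!: derivative_eq_intros)
    from has_vector_derivative_divide[OF this, of "\<i> * of_real \<omega>"]
    show ?thesis using assms(2) by (simp add: scaleR_conv_of_real)
  qed
  moreover have "((\<lambda>t. \<alpha> + \<omega> * t) has_real_derivative \<omega>) (at t)" for t
    by (auto intro!: derivative_eq_intros)
  ultimately show ?thesis
    using steerable_smooth[OF assms(1), of "\<lambda>t. \<alpha> + \<omega> * t" \<omega> ?z] by simp
qed

text \<open>
  The second path is run with its clock shifted by \<open>T\<close>; the junction time joins the exceptional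
  set, since the angular speeds on its two sides need not agree.
\<close>

lemma steerable_concat:
  assumes "steerable T \<alpha> \<beta> v" "steerable T' \<beta> \<gamma> w"
  shows "steerable (T + T') \<alpha> \<gamma> (v + w)"
proof -
  from assms(1) obtain \<phi> z u L S where T: "0 \<le> T"
    and 1: "\<phi> 0 = \<alpha>" "\<phi> T = \<beta>" "z 0 = 0" "z T = v" "L-lipschitz_on {0..T} \<phi>" "1-lipschitz_on {0..T} z"
      "u \<in> borel_measurable borel" "\<forall>t. \<bar>u t\<bar> \<le> L" "finite S"
    and d1: "\<And>t. t \<in> {0<..<T} - S \<Longrightarrow> (\<phi> has_real_derivative u t) (at t)"
      "\<And>t. t \<in> {0<..<T} - S \<Longrightarrow> (z has_vector_derivative cis (\<phi> t)) (at t)"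
    unfolding steerable_def by metis
  from assms(2) obtain \<phi>' z' u' L' S' where T': "0 \<le> T'"
    and 2: "\<phi>' 0 = \<beta>" "\<phi>' T' = \<gamma>" "z' 0 = 0" "z' T' = w" "L'-lipschitz_on {0..T'} \<phi>'" "1-lipschitz_on {0..T'} z'"
      "u' \<in> borel_measurable borel" "\<forall>t. \<bar>u' t\<bar> \<le> L'" "finite S'"
    and d2: "\<And>t. t \<in> {0<..<T'} - S' \<Longrightarrow> (\<phi>' has_real_derivative u' t) (at t)"
      "\<And>t. t \<in> {0<..<T'} - S' \<Longrightarrow> (z' has_vector_derivative cis (\<phi>' t)) (at t)"
    unfolding steerable_def by metis
  define \<Phi> where "\<Phi> t = (if t \<le> T then \<phi> t else \<phi>' (t - T))" for t
  define Z where "Z t = (if t \<le> T then z t else v + z' (t - T))" for t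
  define V where "V t = (if t \<le> T then u t else u' (t - T))" for t
  define R where "R = insert T (S \<union> (+) T ` S')"
  have lip\<phi>: "L'-lipschitz_on {T..T + T'} (\<lambda>t. \<phi>' (t - T))"
  proof (rule lipschitz_onI)
    show "0 \<le> L'" using lipschitz_on_nonneg[OF 2(5)] .
    show "dist (\<phi>' (s - T)) (\<phi>' (t - T)) \<le> L' * dist s t" if "s \<in> {T..T + T'}" "t \<in> {T..T + T'}" for s t
      using lipschitz_onD[OF 2(5), of "s - T" "t - T"] that by (auto simp: dist_real_def)
  qed
  have lipz: "1-lipschitz_on {T..T + T'} (\<lambda>t. v + z' (t - T))"
  proof (rule lipschitz_onI)
    show "dist (v + z' (s - T)) (v + z' (t - T)) \<le> 1 * dist s t" if "s \<in> {T..T + T'}" "t \<in> {T..T + T'}" for s t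
      using lipschitz_onD[OF 2(6), of "s - T" "t - T"] that by (auto simp: dist_real_def)
  qed simp
  have "(max L L')-lipschitz_on {0..T + T'} \<Phi>"
    unfolding \<Phi>_def using 1 2 lip\<phi> by (intro lipschitz_on_concat_max) auto
  moreover have "1-lipschitz_on {0..T + T'} Z"
    unfolding Z_def using 1 2 lipz by (intro lipschitz_on_concat) auto
  moreover have "V \<in> borel_measurable borel"
    unfolding V_def using 1(7) 2(7) by measurable
  moreover have "\<forall>t. \<bar>V t\<bar> \<le> max L L'"
    using 1(8) 2(8) by (auto simp: V_def le_max_iff_disj)
  moreover have "finite R" using 1(9) 2(9) by (simp add: R_def)
  moreover have "\<Phi> 0 = \<alpha>" "\<Phi> (T + T') = \<gamma>" "Z 0 = 0" "Z (T + T') = v + w"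
    using 1 2 T T' by (auto simp: \<Phi>_def Z_def)
  moreover have "(\<Phi> has_real_derivative V t) (at t) \<and> (Z has_vector_derivative cis (\<Phi> t)) (at t)"
    if t: "t \<in> {0<..<T + T'} - R" for t
  proof (cases "t < T")
    case True
    with t have t': "t \<in> {0<..<T} - S" by (auto simp: R_def)
    have "(\<Phi> has_real_derivative u t) (at t)"
      by (rule has_field_derivative_transform_within_open[OF d1(1)[OF t'], of "{0<..<T}"])
        (use t' in \<open>auto simp: \<Phi>_def\<close>)
    moreover have "(Z has_vector_derivative cis (\<phi> t)) (at t)"
      by (rule has_vector_derivative_transform_within_open[OF d1(2)[OF t'], of "{0<..<T}"])
        (use t' in \<open>auto simp: Z_def\<close>)
    ultimately show ?thesis using True by (simp add: \<Phi>_def V_def)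
  next
    case False
    have tR: "t - T \<notin> S'" "t \<noteq> T" using t by (auto simp: R_def image_iff)
    with t False have t': "t - T \<in> {0<..<T'} - S'" "t > T" by auto
    have "((\<lambda>t. \<phi>' (t - T)) has_real_derivative u' (t - T)) (at t)"
      using DERIV_shift[of \<phi>' "u' (t - T)" t "- T"] d2(1)[OF t'(1)] by simp
    then have "(\<Phi> has_real_derivative u' (t - T)) (at t)"
      by (rule has_field_derivative_transform_within_open[of _ _ _ "{T<..}"])
        (use t' in \<open>auto simp: \<Phi>_def\<close>)
    moreover have "((\<lambda>t. v + z' (t - T)) has_vector_derivative cis (\<phi>' (t - T))) (at t)"
    proof -
      have "((\<lambda>t. t - T) has_vector_derivative 1) (at t)"
        by (auto intro!: derivative_eq_intros)
      from vector_diff_chain_at[OF this d2(2)[OF t'(1)]]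
      have "((\<lambda>t. z' (t - T)) has_vector_derivative cis (\<phi>' (t - T))) (at t)"
        by (simp add: o_def)
      then show ?thesis by (auto intro!: derivative_eq_intros)
    qed
    then have "(Z has_vector_derivative cis (\<phi>' (t - T))) (at t)"
      by (rule has_vector_derivative_transform_within_open[of _ _ _ "{T<..}"])
        (use t' in \<open>auto simp: Z_def\<close>)
    ultimately show ?thesis using t' by (simp add: \<Phi>_def V_def)
  qed
  ultimately show ?thesis
    unfolding steerable_def using T T'
    by (intro conjI exI[of _ \<Phi>] exI[of _ Z] exI[of _ V] exI[of _ "max L L'"] exI[of _ R]) auto
qed

text \<open>
  The angle can be changed without any net displacement. Put \<open>\<alpha> = m - \<delta>\<close> and \<open>\<beta> = m + \<delta>\<close>. Turning
  from \<open>\<alpha>\<close> to \<open>\<beta>\<close> at constant speed in time \<open>p\<close> gives the displacement \<open>p * sin \<delta> / \<delta>\<close> in the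
  direction \<open>m\<close>. For \<open>\<delta> \<ge> 2 * pi\<close> the turn passes through the opposite direction \<open>m + pi\<close>; interrupting
  it there to go straight for the time \<open>h = p * sin \<delta> / \<delta>\<close> cancels that displacement. The bounds
  on \<open>\<beta> - \<alpha>\<close> put \<open>\<delta>\<close> between \<open>2 * pi\<close> and \<open>3 * pi\<close>, where \<open>sin \<delta> \<ge> 0\<close>, so \<open>h\<close> is not negative, and
  these bounds cover a full period of \<open>\<beta>\<close>.
\<close>

lemma steerable_in_place:
  assumes s: "0 < s" and \<alpha>\<beta>: "4 * pi \<le> \<beta> - \<alpha>" "\<beta> - \<alpha> \<le> 6 * pi"
  shows "steerable s \<alpha> \<beta> 0"
proof -
  define \<delta> where "\<delta> = (\<beta> - \<alpha>) / 2"
  define m where "m = (\<alpha> + \<beta>) / 2"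
  have ab: "\<alpha> = m - \<delta>" "\<beta> = m + \<delta>" by (auto simp: m_def \<delta>_def field_simps)
  have \<delta>: "2 * pi \<le> \<delta>" "\<delta> \<le> 3 * pi" using \<alpha>\<beta> by (auto simp: \<delta>_def)
  then have \<delta>0: "\<delta> > pi" "\<delta> > 0" using pi_gt_zero by linarith+
  have "sin \<delta> = sin (\<delta> - 2 * pi)" by (simp add: sin_diff)
  also have "\<dots> \<ge> 0" using \<delta> by (intro sin_ge_zero) auto
  finally have sin: "sin \<delta> \<ge> 0" .
  \<comment> \<open>Turning time \<open>p\<close> and straight time \<open>h\<close>, chosen so that \<open>p + h = s\<close>.\<close>
  define p where "p = s / (1 + sin \<delta> / \<delta>)"
  define h where "h = p * (sin \<delta> / \<delta>)"
  define \<omega> where "\<omega> = 2 * \<delta> / p"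
  have den: "1 + sin \<delta> / \<delta> > 0" using sin \<delta>0 by (simp add: add_pos_nonneg)
  have p: "p > 0" using s den by (simp add: p_def)
  have h: "h \<ge> 0" using p sin \<delta>0 by (simp add: h_def)
  have "p + h = p * (1 + sin \<delta> / \<delta>)" by (simp add: h_def distrib_left)
  then have ph: "p + h = s" using den by (simp add: p_def)
  have \<omega>: "\<omega> > 0" using p \<delta>0 by (simp add: \<omega>_def)
  define t1 t2 where "t1 = (\<delta> + pi) / \<omega>" and "t2 = (\<delta> - pi) / \<omega>"
  have t: "t1 \<ge> 0" "t2 \<ge> 0" using \<delta>0 \<omega> by (auto simp: t1_def t2_def intro!: divide_nonneg_pos)
  have "t1 + t2 = 2 * \<delta> / \<omega>" by (simp add: t1_def t2_def add_divide_distrib[symmetric])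
  also have "\<dots> = p" using p \<delta>0 by (simp add: \<omega>_def)
  finally have t12: "t1 + t2 = p" .
  have 1: "steerable t1 \<alpha> (m + pi) ((cis (m + pi) - cis (m - \<delta>)) / (\<i> * of_real \<omega>))"
    using steerable_turn[OF t(1), of \<omega> \<alpha>] \<omega> by (simp add: t1_def ab)
  have 2: "steerable h (m + pi) (m + pi) (of_real h * cis (m + pi))"
    using steerable_straight[OF h] .
  have 3: "steerable t2 (m + pi) \<beta> ((cis (m + \<delta>) - cis (m + pi)) / (\<i> * of_real \<omega>))"
    using steerable_turn[OF t(2), of \<omega> "m + pi"] \<omega> by (simp add: t2_def ab)
  have "(cis (m + pi) - cis (m - \<delta>)) / (\<i> * of_real \<omega>) + of_real h * cis (m + pi)
      + (cis (m + \<delta>) - cis (m + pi)) / (\<i> * of_real \<omega>)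
     = (cis (m + \<delta>) - cis (m - \<delta>)) / (\<i> * of_real \<omega>) - of_real h * cis m"
    by (simp add: diff_divide_distrib add_divide_distrib cis_mult[symmetric])
  also have "cis (m + \<delta>) - cis (m - \<delta>) = 2 * \<i> * of_real (sin \<delta>) * cis m"
    by (simp add: complex_eq_iff cos_add cos_diff sin_add sin_diff)
  also have "2 * \<i> * of_real (sin \<delta>) * cis m / (\<i> * of_real \<omega>) = of_real (2 * sin \<delta> / \<omega>) * cis m"
    by simp
  also have "2 * sin \<delta> / \<omega> = h" using p \<delta>0 by (simp add: \<omega>_def h_def)
  finally show ?thesis
    using steerable_concat[OF steerable_concat[OF 1 2] 3] t12 ph by (simp add: algebra_simps)
qed

lemma angle_shift_into_window:
  fixes a c :: real
  obtains k :: int where "c \<le> a + of_int k * (2 * pi)" "a + of_int k * (2 * pi) \<le> c + 2 * pi"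
proof -
  define k where "k = \<lceil>(c - a) / (2 * pi)\<rceil>"
  have "(c - a) / (2 * pi) \<le> of_int k" "of_int k \<le> (c - a) / (2 * pi) + 1"
    unfolding k_def by linarith+
  then have "c - a \<le> of_int k * (2 * pi)" "of_int k * (2 * pi) \<le> c - a + 2 * pi"
    using pi_gt_zero by (auto simp: field_simps)
  with that[of k] show thesis by simp
qed

text \<open>
  Turn in place towards \<open>w\<close>, go straight for the time \<open>cmod w\<close>, and turn in place to the final
  angle. The time \<open>T - cmod w\<close> left for the two turns is positive because \<open>w\<close> lies in the open disc.
\<close>

lemma steerable_disc:
  assumes "cmod w < T"
  obtains k :: int where "steerable T \<alpha> (\<beta> + of_int k * (2 * pi)) w"
proof -
  define s where "s = (T - cmod w) / 2"
  have s: "s > 0" using assms by (simp add: s_def)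
  obtain j :: int where j: "\<alpha> + 4 * pi \<le> Arg w + of_int j * (2 * pi)"
    "Arg w + of_int j * (2 * pi) \<le> \<alpha> + 4 * pi + 2 * pi"
    by (rule angle_shift_into_window)
  define \<psi> where "\<psi> = Arg w + of_int j * (2 * pi)"
  obtain k :: int where k: "\<psi> + 4 * pi \<le> \<beta> + of_int k * (2 * pi)"
    "\<beta> + of_int k * (2 * pi) \<le> \<psi> + 4 * pi + 2 * pi"
    by (rule angle_shift_into_window)
  have "of_real (cmod w) * cis \<psi> = rcis (cmod w) (Arg w)"
    by (simp add: \<psi>_def rcis_def complex_eq_iff cos_add sin_add mult.commute[of _ "2 * pi"])
  then have w: "of_real (cmod w) * cis \<psi> = w" by (simp add: rcis_cmod_Arg)
  have "steerable s \<alpha> \<psi> 0" using j s by (intro steerable_in_place) (auto simp: \<psi>_def)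
  moreover have "steerable (cmod w) \<psi> \<psi> w" using steerable_straight[of "cmod w" \<psi>] w by simp
  moreover have "steerable s \<psi> (\<beta> + of_int k * (2 * pi)) 0"
    using k s by (intro steerable_in_place) auto
  ultimately have "steerable (s + cmod w + s) \<alpha> (\<beta> + of_int k * (2 * pi)) (0 + w + 0)"
    by (intro steerable_concat)
  moreover have "s + cmod w + s = T" by (simp add: s_def)
  ultimately show thesis using that by simp
qed

section \<open>From steering to attainability\<close>

lemma dist_circle_le: "dist (abs_circle x) (abs_circle y) \<le> \<bar>x - y\<bar>"
  unfolding dist_circle_def by (metis dist_real_def mem_Collect_eq setdist_le_dist)

text \<open>
  The control is bounded, hence square integrable on \<open>{0..T}\<close>, and the curve is Lipschitz, hence
  absolutely continuous. The exceptional times and the two endpoints form a finite, hence null, set.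
\<close>

lemma steerable_imp_attainable:
  assumes "steerable T \<alpha> \<beta> w"
  shows "(x\<^sub>0 + Re w, y\<^sub>0 + Im w, abs_circle \<beta>) \<in> attainable_set (x\<^sub>0, y\<^sub>0, abs_circle \<alpha>) T"
proof -
  from assms obtain \<phi> z u L S where T: "0 \<le> T"
    and 1: "\<phi> 0 = \<alpha>" "\<phi> T = \<beta>" "z 0 = 0" "z T = w" "L-lipschitz_on {0..T} \<phi>" "1-lipschitz_on {0..T} z"
      "u \<in> borel_measurable borel" "\<forall>t. \<bar>u t\<bar> \<le> L" "finite S"
    and d: "\<And>t. t \<in> {0<..<T} - S \<Longrightarrow> (\<phi> has_real_derivative u t) (at t)"
      "\<And>t. t \<in> {0<..<T} - S \<Longrightarrow> (z has_vector_derivative cis (\<phi> t)) (at t)"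
    unfolding steerable_def by metis
  define q where "q t = (x\<^sub>0 + Re (z t), y\<^sub>0 + Im (z t), abs_circle (\<phi> t))" for t
  have u: "admissible_control T u"
    unfolding admissible_control_def
  proof
    have "u \<in> borel_measurable lebesgue"
      using measurable_completion[of u lborel borel] 1(7) by simp
    then show meas: "u \<in> borel_measurable (lebesgue_on {0..T})"
      by (rule measurable_restrict_space1)
    have "finite_measure (lebesgue_on {0..T})"
      by (intro finite_measure_lebesgue_on) auto
    moreover have "(u t)\<^sup>2 \<le> L\<^sup>2" for t
      using 1(8) by (intro abs_le_square_iff[THEN iffD1]) (auto intro: order_trans[OF _ abs_ge_self])
    ultimately show "integrable (lebesgue_on {0..T}) (\<lambda>t. (u t)\<^sup>2)"
      using meas by (intro finite_measure.integrable_const_bound[where B = "L\<^sup>2"]) auto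
  qed
  have "absolutely_continuous_curve 0 T q"
  proof (rule absolutely_continuous_curve_dominated)
    show "absolutely_continuous_curve 0 T (\<lambda>_. 0 :: real)"
      by (auto simp: absolutely_continuous_curve_def intro: exI[of _ 1])
    fix s t assume st: "s \<in> {0..T}" "t \<in> {0..T}"
    have "dist (z s) (z t) \<le> \<bar>s - t\<bar>"
      using lipschitz_onD[OF 1(6) st] by (simp add: dist_real_def)
    then have "\<bar>Re (z s) - Re (z t)\<bar> \<le> \<bar>s - t\<bar>" "\<bar>Im (z s) - Im (z t)\<bar> \<le> \<bar>s - t\<bar>"
      using abs_Re_le_cmod[of "z s - z t"] abs_Im_le_cmod[of "z s - z t"] by (auto simp: dist_norm)
    moreover have "dist (abs_circle (\<phi> s)) (abs_circle (\<phi> t)) \<le> L * \<bar>s - t\<bar>"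
      using lipschitz_onD[OF 1(5) st] dist_circle_le[of "\<phi> s" "\<phi> t"] by (simp add: dist_real_def)
    moreover have "dist (q s) (q t) \<le> dist (fst (q s)) (fst (q t)) +
        (dist (fst (snd (q s))) (fst (snd (q t))) + dist (snd (snd (q s))) (snd (snd (q t))))"
      unfolding dist_prod_def by (intro order_trans[OF sqrt_sum_squares_le_sum] add_left_mono) auto
    ultimately show "dist (q s) (q t) \<le> (2 + L) * \<bar>s - t\<bar> + 0 * dist (0::real) 0"
      by (simp add: q_def dist_real_def algebra_simps)
  qed
  moreover have "AE t in lebesgue_on {0..T}.
      ((\<lambda>t. fst (q t)) has_real_derivative cos_circle (snd (snd (q t)))) (at t within {0..T}) \<and>
      ((\<lambda>t. fst (snd (q t))) has_real_derivative sin_circle (snd (snd (q t)))) (at t within {0..T}) \<and>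
      has_circle_derivative (\<lambda>t. snd (snd (q t))) (u t) t {0..T}" (is "AE t in _. ?P t")
  proof -
    have P: "?P t" if t: "t \<in> {0<..<T} - S" for t
    proof (intro conjI)
      have z: "(z has_vector_derivative cis (\<phi> t)) (at t within {0..T})"
        using d(2)[OF t] by (rule has_vector_derivative_at_within)
      have "((\<lambda>t. Re (z t)) has_real_derivative cos (\<phi> t)) (at t within {0..T})"
        "((\<lambda>t. Im (z t)) has_real_derivative sin (\<phi> t)) (at t within {0..T})"
        using bounded_linear.has_vector_derivative[OF bounded_linear_Re z]
          bounded_linear.has_vector_derivative[OF bounded_linear_Im z]
        by (auto simp: has_real_derivative_iff_has_vector_derivative)
      then show "((\<lambda>t. fst (q t)) has_real_derivative cos_circle (snd (snd (q t)))) (at t within {0..T})"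
        "((\<lambda>t. fst (snd (q t))) has_real_derivative sin_circle (snd (snd (q t)))) (at t within {0..T})"
        by (auto simp: q_def cos_circle.abs_eq sin_circle.abs_eq intro!: DERIV_add[OF DERIV_const, simplified])
      show "has_circle_derivative (\<lambda>t. snd (snd (q t))) (u t) t {0..T}"
        unfolding has_circle_derivative_def
        using DERIV_subset[OF d(1)[OF t], of "{0..T}"] by (intro exI[of _ \<phi>]) (auto simp: q_def)
    qed
    have "negligible (insert 0 (insert T S))" using 1(9) by (intro negligible_finite) auto
    then have "AE t in lebesgue. t \<in> {0..T} \<longrightarrow> ?P t"
      unfolding eventually_ae_filter_negligible using P
      by (intro exI[of _ "insert 0 (insert T S)"]) force
    then show ?thesis by (subst AE_restrict_space_iff) auto
  qed
  ultimately have "trajectory T u q"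
    unfolding trajectory_def Let_def by blast
  then have "q T \<in> attainable_set (q 0) T"
    unfolding attainable_set_def using u by blast
  then show ?thesis using 1 by (simp add: q_def)
qed

theorem theorem4p1:
  fixes x\<^sub>0 y\<^sub>0 t\<^sub>1 :: real and \<theta>\<^sub>0 :: circle
  assumes "t\<^sub>1 > 0"
  shows "attainable_set (x\<^sub>0, y\<^sub>0, \<theta>\<^sub>0) t\<^sub>1 =
    {(x, y, \<theta>).
       (x - x\<^sub>0)\<^sup>2 + (y - y\<^sub>0)\<^sup>2 < t\<^sub>1\<^sup>2 \<or>
       (x, y, \<theta>) = (x\<^sub>0 + t\<^sub>1 * cos_circle \<theta>\<^sub>0, y\<^sub>0 + t\<^sub>1 * sin_circle \<theta>\<^sub>0, \<theta>\<^sub>0)}"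
    (is "?A = ?R")
proof
  show "?A \<subseteq> ?R"
  proof
    fix p assume "p \<in> ?A"
    then obtain q u where q: "p = q t\<^sub>1" "trajectory t\<^sub>1 u q" "q 0 = (x\<^sub>0, y\<^sub>0, \<theta>\<^sub>0)"
      unfolding attainable_set_def by blast
    obtain x y \<theta> where p: "q t\<^sub>1 = (x, y, \<theta>)" by (cases "q t\<^sub>1")
    show "p \<in> ?R"
      using trajectory_endpoint_cases[OF assms q(2,3) p] q(1) p by simp
  qed
  obtain \<alpha> where \<alpha>: "\<theta>\<^sub>0 = abs_circle \<alpha>" by (rule abs_circle_cases)
  show "?R \<subseteq> ?A"
  proof
    fix p assume "p \<in> ?R"
    then obtain x y \<theta> where p: "p = (x, y, \<theta>)" and cases:
      "(x - x\<^sub>0)\<^sup>2 + (y - y\<^sub>0)\<^sup>2 < t\<^sub>1\<^sup>2 \<or>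
       (x, y, \<theta>) = (x\<^sub>0 + t\<^sub>1 * cos_circle \<theta>\<^sub>0, y\<^sub>0 + t\<^sub>1 * sin_circle \<theta>\<^sub>0, \<theta>\<^sub>0)"
      by auto
    from cases show "p \<in> ?A"
    proof
      assume disc: "(x - x\<^sub>0)\<^sup>2 + (y - y\<^sub>0)\<^sup>2 < t\<^sub>1\<^sup>2"
      obtain \<beta> where \<beta>: "\<theta> = abs_circle \<beta>" by (rule abs_circle_cases)
      let ?w = "Complex (x - x\<^sub>0) (y - y\<^sub>0)"
      have "(cmod ?w)\<^sup>2 < t\<^sub>1\<^sup>2" using disc by (simp add: cmod_power2)
      then have "cmod ?w < t\<^sub>1" using assms by (simp add: power_less_imp_less_base)
      then obtain k :: int where "steerable t\<^sub>1 \<alpha> (\<beta> + of_int k * (2 * pi)) ?w"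
        by (rule steerable_disc)
      moreover have "abs_circle (\<beta> + of_int k * (2 * pi)) = \<theta>"
        using \<beta> abs_circle_eq_iff by metis
      ultimately show ?thesis
        using steerable_imp_attainable[of t\<^sub>1 \<alpha> _ ?w x\<^sub>0 y\<^sub>0] \<alpha> p by fastforce
    next
      assume "(x, y, \<theta>) = (x\<^sub>0 + t\<^sub>1 * cos_circle \<theta>\<^sub>0, y\<^sub>0 + t\<^sub>1 * sin_circle \<theta>\<^sub>0, \<theta>\<^sub>0)"
      then show ?thesis
        using steerable_imp_attainable[OF steerable_straight[of t\<^sub>1 \<alpha>], of x\<^sub>0 y\<^sub>0] assms \<alpha> p
        by (simp add: cos_circle.abs_eq sin_circle.abs_eq)
    qed
  qed
qed

end
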